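(* For each integer $d \geq 1$, there exists a graph $G$ such that $\mathsf{dc}(G) = d$ and $\chi_{ON}(G) > d$.
   Context: A CFON coloring of a graph $G=(V,E)$ with $k$ colors is a map $C: V \to \{1,\dots,k\}$ such that for every $v \in V$ there is a color $i$ with $|N(v)\cap C^{-1}(i)| = 1$, where $N(v)$ is the open neighborhood of $v$. $\chi_{ON}(G)$ is the minimum $k$ for which a CFON coloring with $k$ colors exists. The distance to cluster $\mathsf{dc}(G)$ is the size of a smallest set $X \subseteq V$ such that $G[V\setminus X]$ is a disjoint union of cliques. *)

theory Defs
  imports "Graph_Theory.Digraph_Component" "HOL-Library.FuncSet" "HOL-Library.Disjoint_Sets"
begin

text \<open>
  A finite simple undirected graph is a \<open>pair_graph\<close>: a finite vertex set with a finite,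
  symmetric and irreflexive set of arcs, an edge being represented by its two opposite arcs.
\<close>

definition open_nbhd :: "('a, 'b) pre_digraph \<Rightarrow> 'a \<Rightarrow> 'a set" where
  "open_nbhd G v = {u \<in> verts G. v \<rightarrow>\<^bsub>G\<^esub> u}"

definition CFON_coloring :: "('a, 'b) pre_digraph \<Rightarrow> nat \<Rightarrow> ('a \<Rightarrow> nat) \<Rightarrow> bool" where
  "CFON_coloring G k C \<longleftrightarrow> C \<in> verts G \<rightarrow> {1..k} \<and>
     (\<forall>v \<in> verts G. \<exists>i \<in> {1..k}. card (open_nbhd G v \<inter> C -` {i}) = 1)"

text \<open>
  A graph with an isolated vertex has no CFON coloring at all, and then \<open>chi_ON\<close> is a
  meaningless value; so \<open>CFON_colorable\<close> has to accompany every use of \<open>chi_ON\<close>.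
  A finite graph is \<open>CFON_colorable\<close> iff it has no isolated vertex.
\<close>

definition CFON_colorable :: "('a, 'b) pre_digraph \<Rightarrow> bool" where
  "CFON_colorable G \<longleftrightarrow> (\<exists>k C. CFON_coloring G k C)"

definition chi_ON :: "('a, 'b) pre_digraph \<Rightarrow> nat" where
  "chi_ON G = (LEAST k. \<exists>C. CFON_coloring G k C)"

text \<open>A disjoint union of cliques, the blocks of \<open>P\<close> being the vertex sets of the cliques.\<close>

definition disjoint_union_of_cliques :: "('a, 'b) pre_digraph \<Rightarrow> bool" where
  "disjoint_union_of_cliques G \<longleftrightarrow>
     (\<exists>P. partition_on (verts G) P \<and>
          arcs_ends G = {(u, v). u \<noteq> v \<and> (\<exists>K \<in> P. u \<in> K \<and> v \<in> K)})"

text \<open>For finite \<open>G\<close> the minimum exists, since \<open>X = verts G\<close> leaves the empty graph.\<close>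

definition dist_to_cluster :: "('a, 'b) pre_digraph \<Rightarrow> nat" where
  "dist_to_cluster G = (LEAST k. \<exists>X \<subseteq> verts G. finite X \<and> card X = k \<and>
     disjoint_union_of_cliques (G \<restriction> (verts G - X)))"

end

theory Submission
  imports Defs
begin

text \<open>
  Take vertices \<open>x\<^sub>i\<close> for \<open>i < d\<close>, a vertex \<open>w\<^sub>i\<^sub>j\<close> with
  neighborhood \<open>{x\<^sub>i, x\<^sub>j}\<close> for all \<open>i, j < d\<close>, and one big clique consisting of
  \<open>d + 1\<close> copies of a vertex adjacent to exactly the \<open>x\<^sub>i\<close> with \<open>i \<in> S\<close>, for every
  \<open>S \<subseteq> {..<d}\<close>. Deleting the \<open>x\<^sub>i\<close> leaves a cluster graph, and the induced paths
  \<open>w\<^sub>i\<^sub>i - x\<^sub>i - u\<close>, with \<open>u\<close> a copy for \<open>S = {i}\<close>, are disjoint, so the distance to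
  cluster is \<open>d\<close>. In a CFON coloring the \<open>w\<^sub>i\<^sub>j\<close> force the \<open>x\<^sub>i\<close> to have distinct colors. If
  there were at most \<open>d\<close> colors, the \<open>x\<^sub>i\<close> would show each color once. Let \<open>S\<close> consist of the \<open>i\<close>
  such that the color of \<open>x\<^sub>i\<close> occurs in the clique. Two of the copies for \<open>S\<close> share a color, and
  such a copy sees every color of the clique at least twice and no other color.
\<close>

subsection \<open>Graphs from adjacency relations\<close>

text \<open>The construction is natural on a structured vertex type, whereas the final graph lives
  on \<open>nat\<close>. An injection \<open>f\<close> transports it, and the lemmas below pull
  every graph notion back to \<open>V\<close> and \<open>A\<close>.\<close>

definition relabeled_graph :: "('a \<Rightarrow> nat) \<Rightarrow> 'a set \<Rightarrow> ('a \<Rightarrow> 'a \<Rightarrow> bool) \<Rightarrow> nat pair_pre_digraph" where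
  "relabeled_graph f V A = \<lparr>pverts = f ` V, parcs = {(f u, f v) |u v. u \<in> V \<and> v \<in> V \<and> A u v}\<rparr>"

lemma pair_graph_relabeled:
  assumes "finite V" "inj_on f V" "symp A" "irreflp A"
  shows "pair_graph (relabeled_graph f V A)"
proof
  let ?G = "relabeled_graph f V A"
  show "finite (pverts ?G)"
    using assms(1) by (simp add: relabeled_graph_def)
  have "parcs ?G \<subseteq> (f ` V) \<times> (f ` V)"
    by (auto simp: relabeled_graph_def)
  then show "finite (parcs ?G)"
    using assms(1) by (meson finite_SigmaI finite_imageI finite_subset)
  show "fst e \<in> pverts ?G" "snd e \<in> pverts ?G" if "e \<in> parcs ?G" for e
    using that by (auto simp: relabeled_graph_def)
  show "fst e \<noteq> snd e" if "e \<in> parcs ?G" for e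
    using that assms(2,4) by (auto simp: relabeled_graph_def inj_on_eq_iff irreflp_def)
  have "sym (parcs ?G)"
    using assms(3) by (auto simp: relabeled_graph_def sym_def symp_def)
  then show "symmetric ?G"
    by (simp add: symmetric_def arcs_ends_def arc_to_ends_def)
qed

lemma verts_relabeled: "verts (with_proj (relabeled_graph f V A)) = f ` V"
  by (simp add: relabeled_graph_def)

lemma open_nbhd_relabeled:
  assumes "inj_on f V" "v \<in> V"
  shows "open_nbhd (with_proj (relabeled_graph f V A)) (f v) = f ` {u \<in> V. A v u}"
  using assms
  by (auto simp: open_nbhd_def relabeled_graph_def arcs_ends_def arc_to_ends_def inj_on_eq_iff)

lemma card_open_nbhd_relabeled:
  assumes "inj_on f V" "v \<in> V"
  shows "card (open_nbhd (with_proj (relabeled_graph f V A)) (f v) \<inter> C -` {i})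
           = card {u \<in> V. A v u \<and> C (f u) = i}"
proof -
  have "open_nbhd (with_proj (relabeled_graph f V A)) (f v) \<inter> C -` {i}
          = f ` {u \<in> V. A v u \<and> C (f u) = i}"
    unfolding open_nbhd_relabeled[OF assms] by auto
  moreover have "inj_on f {u \<in> V. A v u \<and> C (f u) = i}"
    using assms(1) by (rule inj_on_subset) auto
  ultimately show ?thesis
    by (simp add: card_image)
qed

lemma CFON_colorable_relabeled:
  assumes fin: "finite V" and inj: "inj_on f V" and nbr: "\<And>v. v \<in> V \<Longrightarrow> \<exists>u\<in>V. A v u"
  shows "CFON_colorable (with_proj (relabeled_graph f V A))"
proof -
  obtain k where k: "\<And>v. v \<in> V \<Longrightarrow> f v < k"
    using finite_nat_set_iff_bounded[of "f ` V"] fin by auto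
  \<comment> \<open>The rainbow coloring, each label being its own color, makes any neighbor the
    only one of its color. \<open>Suc\<close> shifts the labels because colors start at 1.\<close>
  have "CFON_coloring (with_proj (relabeled_graph f V A)) k Suc"
    unfolding CFON_coloring_def verts_relabeled
  proof (intro conjI ballI)
    show "Suc \<in> f ` V \<rightarrow> {1..k}"
      using k by fastforce
    fix x assume "x \<in> f ` V"
    then obtain v where v: "v \<in> V" "x = f v" by auto
    then obtain u where u: "u \<in> V" "A v u" using nbr by blast
    have "{t \<in> V. A v t \<and> Suc (f t) = Suc (f u)} = {u}"
      using u inj by (auto simp: inj_on_eq_iff)
    then have "card (open_nbhd (with_proj (relabeled_graph f V A)) x \<inter> Suc -` {Suc (f u)}) = 1"
      unfolding v(2) card_open_nbhd_relabeled[OF inj v(1)] by simp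
    moreover have "Suc (f u) \<in> {1..k}"
      using k[OF u(1)] by simp
    ultimately show "\<exists>i\<in>{1..k}. card (open_nbhd (with_proj (relabeled_graph f V A)) x \<inter> Suc -` {i}) = 1"
      by blast
  qed
  then show ?thesis unfolding CFON_colorable_def by blast
qed

lemma arcs_ends_induce_relabeled:
  assumes "inj_on f V" "Z \<subseteq> V"
  shows "arcs_ends (with_proj (relabeled_graph f V A) \<restriction> (f ` V - f ` Z))
           = {(f u, f v) |u v. u \<in> V - Z \<and> v \<in> V - Z \<and> A u v}"
proof -
  have "f ` V - f ` Z = f ` (V - Z)"
    using assms by (simp add: inj_on_image_set_diff[where C = V])
  moreover have "arcs_ends (with_proj (relabeled_graph f V A) \<restriction> S)
      = parcs (relabeled_graph f V A) \<inter> S \<times> S" for S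
    by (auto simp: arcs_ends_def arc_to_ends_def)
  moreover have "f u \<in> f ` (V - Z) \<longleftrightarrow> u \<in> V - Z" if "u \<in> V" for u
    using that assms by (auto simp: inj_on_eq_iff)
  ultimately show ?thesis
    by (auto simp: relabeled_graph_def)
qed

section \<open>Cluster graphs and disjoint obstructions\<close>

text \<open>The block of \<open>v\<close> is unique, so it contains both \<open>u\<close> and
  \<open>w\<close>. Hence no induced path on three vertices survives in a cluster graph.\<close>

lemma disjoint_union_of_cliques_trans:
  assumes "disjoint_union_of_cliques G" "(u, v) \<in> arcs_ends G" "(v, w) \<in> arcs_ends G" "u \<noteq> w"
  shows "(u, w) \<in> arcs_ends G"
proof -
  obtain P where P: "partition_on (verts G) P"
      "arcs_ends G = {(u, v). u \<noteq> v \<and> (\<exists>K \<in> P. u \<in> K \<and> v \<in> K)}"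
    using assms(1) unfolding disjoint_union_of_cliques_def by blast
  obtain K where K: "K \<in> P" "u \<in> K" "v \<in> K"
    using assms(2) unfolding P(2) by auto
  obtain L where L: "L \<in> P" "v \<in> L" "w \<in> L"
    using assms(3) unfolding P(2) by auto
  have "K = L"
    using partition_onD2[OF P(1)] K L by (auto dest: disjointD)
  then show ?thesis
    using K L assms(4) unfolding P(2) by auto
qed

text \<open>The packing bound: choosing one point of \<open>X\<close> in each \<open>B i\<close>
  gives an injection. It turns disjoint induced paths into a lower bound on deletion sets.\<close>

lemma card_ge_if_disjoint_hit:
  fixes d :: nat
  assumes "finite X" "\<And>i. i < d \<Longrightarrow> B i \<inter> X \<noteq> {}"
    "\<And>i j. i < d \<Longrightarrow> j < d \<Longrightarrow> i \<noteq> j \<Longrightarrow> B i \<inter> B j = {}"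
  shows "d \<le> card X"
proof -
  have "\<forall>i \<in> {..<d}. \<exists>b. b \<in> B i \<inter> X"
    using assms(2) by blast
  then obtain g where g: "\<And>i. i < d \<Longrightarrow> g i \<in> B i \<inter> X"
    unfolding bchoice_iff by blast
  have "inj_on g {..<d}"
  proof (rule inj_onI)
    fix i j assume "i \<in> {..<d}" "j \<in> {..<d}" "g i = g j"
    then show "i = j" using g[of i] g[of j] assms(3)[of i j] by auto
  qed
  moreover have "g ` {..<d} \<subseteq> X" using g by auto
  ultimately show ?thesis
    using card_inj_on_le[of g "{..<d}" X] assms(1) by simp
qed

subsection \<open>The extremal graph\<close>

datatype vertex = X nat | W nat nat | U "nat set" nat

fun adj :: "vertex \<Rightarrow> vertex \<Rightarrow> bool" where
  "adj (X i) (W a b) \<longleftrightarrow> i = a \<or> i = b"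
| "adj (W a b) (X i) \<longleftrightarrow> i = a \<or> i = b"
| "adj (X i) (U S j) \<longleftrightarrow> i \<in> S"
| "adj (U S j) (X i) \<longleftrightarrow> i \<in> S"
| "adj (U S j) (U T k) \<longleftrightarrow> U S j \<noteq> U T k"
| "adj _ _ \<longleftrightarrow> False"

lemma adj_commute: "adj u v = adj v u"
  by (cases u; cases v) auto

lemma not_adj_self: "\<not> adj v v"
  by (cases v) auto

definition hubs :: "nat \<Rightarrow> vertex set" where
  "hubs d = X ` {..<d}"

text \<open>The diagonal is included on purpose: \<open>W i i\<close> is a pendant vertex at
  \<open>X i\<close>, hence an end of an induced path through \<open>X i\<close>.\<close>

definition links :: "nat \<Rightarrow> vertex set" where
  "links d = case_prod W ` ({..<d} \<times> {..<d})"

definition big_clique :: "nat \<Rightarrow> vertex set" where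
  "big_clique d = case_prod U ` (Pow {..<d} \<times> {..d})"

definition vertices :: "nat \<Rightarrow> vertex set" where
  "vertices d = hubs d \<union> links d \<union> big_clique d"

lemmas vertex_set_defs = vertices_def hubs_def links_def big_clique_def

lemma vertices_iff:
  "X i \<in> vertices d \<longleftrightarrow> i < d"
  "W i j \<in> vertices d \<longleftrightarrow> i < d \<and> j < d"
  "U S k \<in> vertices d \<longleftrightarrow> S \<subseteq> {..<d} \<and> k \<le> d"
  by (force simp: vertex_set_defs)+

lemma finite_vertices: "finite (vertices d)"
  by (simp add: vertex_set_defs)

lemma no_isolated_vertex:
  assumes "d \<ge> 1" "v \<in> vertices d"
  shows "\<exists>u \<in> vertices d. adj v u"
proof (cases v)
  case (X i)
  then show ?thesis using assms by (intro bexI[of _ "W i i"]) (auto simp: vertices_iff)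
next
  case (W i j)
  then show ?thesis using assms by (intro bexI[of _ "X i"]) (auto simp: vertices_iff)
next
  case (U S k)
  \<comment> \<open>Another copy for the same \<open>S\<close> is a neighbor; index 1 is available
    because \<open>d \<ge> 1\<close>.\<close>
  then show ?thesis using assms
    by (intro bexI[of _ "U S (if k = 0 then 1 else 0)"]) (auto simp: vertices_iff)
qed

definition extremal_graph :: "nat \<Rightarrow> (vertex \<Rightarrow> nat) \<Rightarrow> nat pair_pre_digraph" where
  "extremal_graph d f = relabeled_graph f (vertices d) adj"

section \<open>Lower bound on the number of colors\<close>

lemma CFON_coloring_extremal_graph:
  assumes inj: "inj_on f (vertices d)"
    and col: "CFON_coloring (with_proj (extremal_graph d f)) k C"
  shows "d < k"
proof (rule ccontr)
  assume "\<not> d < k"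
  define c where "c v = C (f v)" for v
  have range: "c v \<in> {1..k}" if "v \<in> vertices d" for v
    using col that unfolding CFON_coloring_def extremal_graph_def verts_relabeled c_def by auto
  have unique: "\<exists>i \<in> {1..k}. card {u \<in> vertices d. adj v u \<and> c u = i} = 1"
    if "v \<in> vertices d" for v
    using col that
    unfolding CFON_coloring_def extremal_graph_def verts_relabeled c_def
      card_open_nbhd_relabeled[OF inj that, symmetric]
    by blast

  have inj_c: "inj_on (\<lambda>i. c (X i)) {..<d}"
  proof (rule inj_onI, rule ccontr)
    fix i j assume ij: "i \<in> {..<d}" "j \<in> {..<d}" "c (X i) = c (X j)" "i \<noteq> j"
    then obtain l where l: "card {u \<in> vertices d. adj (W i j) u \<and> c u = l} = 1"
      using unique[of "W i j"] by (auto simp: vertices_iff)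
    \<comment> \<open>If both neighbors of \<open>W i j\<close> had the same color, every color
      would occur zero or two times around it, never once.\<close>
    have "{u \<in> vertices d. adj (W i j) u} = {X i, X j}"
    proof (intro set_eqI)
      fix u show "u \<in> {u \<in> vertices d. adj (W i j) u} \<longleftrightarrow> u \<in> {X i, X j}"
        using ij by (cases u) (auto simp: vertices_iff)
    qed
    then have "{u \<in> vertices d. adj (W i j) u \<and> c u = l} = {u \<in> {X i, X j}. c u = l}"
      by blast
    also have "\<dots> = (if c (X j) = l then {X i, X j} else {})"
      unfolding ij(3)[symmetric] using ij(3) by (cases "c (X i) = l") force+
    finally show False using l ij(4) by (simp split: if_splits)
  qed
  \<comment> \<open>The hubs carry \<open>d\<close> distinct colors among \<open>k \<le> d\<close>,
    so every color occurs on a hub.\<close>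
  have surj_c: "(\<lambda>i. c (X i)) ` {..<d} = {1..k}"
  proof (rule card_seteq)
    show "(\<lambda>i. c (X i)) ` {..<d} \<subseteq> {1..k}"
      using range by (auto simp: vertices_iff)
    show "card {1..k} \<le> card ((\<lambda>i. c (X i)) ` {..<d})"
      using inj_c \<open>\<not> d < k\<close> by (simp add: card_image)
  qed simp

  define S where "S = {i \<in> {..<d}. c (X i) \<in> c ` big_clique d}"
  have copy: "U S j \<in> vertices d" "U S j \<in> big_clique d" if "j \<le> d" for j
    using that by (auto simp: vertices_iff S_def big_clique_def)
  \<comment> \<open>Pigeonhole: \<open>{..d}\<close> indexes \<open>d + 1\<close> copies, but there
    are at most \<open>d\<close> colors.\<close>
  have "\<not> inj_on (\<lambda>j. c (U S j)) {..d}"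
  proof
    assume "inj_on (\<lambda>j. c (U S j)) {..d}"
    moreover have "(\<lambda>j. c (U S j)) ` {..d} \<subseteq> {1..k}"
      using range copy by auto
    ultimately have "card {..d} \<le> card {1..k}"
      by (rule card_inj_on_le) simp
    then show False using \<open>\<not> d < k\<close> by simp
  qed
  then obtain j j' where j: "j \<le> d" "j' \<le> d" "j \<noteq> j'" "c (U S j) = c (U S j')"
    unfolding inj_on_def by auto
  obtain i where i: "i \<in> {1..k}" and "card {u \<in> vertices d. adj (U S j) u \<and> c u = i} = 1"
    using unique[OF copy(1)[OF j(1)]] by blast
  then obtain a where a: "{u \<in> vertices d. adj (U S j) u \<and> c u = i} = {a}"
    by (auto simp: card_1_singleton_iff)
  show False
  proof (cases "i \<in> c ` big_clique d")
    case True
    then obtain u where u: "u \<in> big_clique d" "c u = i" by auto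
    \<comment> \<open>The vertex \<open>U S j\<close> is not its own neighbor. If it is the clique
      vertex found with color \<open>i\<close>, its equally colored twin \<open>U S j'\<close>
      replaces it, so \<open>u'\<close> is a neighbor of color \<open>i\<close> in any case.\<close>
    define u' where "u' = (if u = U S j then U S j' else u)"
    have u': "u' \<in> big_clique d" "c u' = i" "u' \<noteq> U S j"
      using u j copy by (auto simp: u'_def)
    then have "u' \<in> {u \<in> vertices d. adj (U S j) u \<and> c u = i}"
      by (auto simp: big_clique_def vertices_iff)
    \<comment> \<open>A second neighbor of color \<open>i\<close>: some hub has this color, and its
      index lies in \<open>S\<close> because the color occurs in the clique.\<close>
    moreover obtain l where l: "l < d" "c (X l) = i"
      using i surj_c by (metis imageE lessThan_iff)
    moreover from l have "X l \<in> {u \<in> vertices d. adj (U S j) u \<and> c u = i}"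
      using True by (auto simp: S_def vertices_iff)
    ultimately have "u' = X l" using a by simp
    then show False using u'(1) by (auto simp: big_clique_def)
  next
    \<comment> \<open>A color absent from the clique cannot be seen at all: the adjacent hubs have
      indices in \<open>S\<close>, hence colors of the clique, and all other neighbors are clique
      vertices.\<close>
    case False
    have a': "a \<in> vertices d" "adj (U S j) a" "c a = i"
      using a by auto
    show False
    proof (cases a)
      case (X l)
      then show False using a' False by (auto simp: S_def)
    next
      case (W p q)
      then show False using a' by simp
    next
      case (U T q)
      then have "a \<in> big_clique d" using a' by (auto simp: big_clique_def vertices_iff)
      then show False using a' False by auto
    qed
  qed
qed

section \<open>Distance to cluster of the extremal graph\<close>

text \<open>Links are adjacent to hubs only, so without the hubs they are isolated and form
  singleton blocks next to the big clique.\<close>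

lemma hubs_deletion_cluster:
  assumes inj: "inj_on f (vertices d)"
  shows "disjoint_union_of_cliques (with_proj (extremal_graph d f) \<restriction> (f ` vertices d - f ` hubs d))"
proof -
  define P where "P = insert (f ` big_clique d) ((\<lambda>w. {f w}) ` links d)"
  have sub: "hubs d \<subseteq> vertices d" by (auto simp: vertices_def)
  have rest: "vertices d - hubs d = big_clique d \<union> links d"
    by (auto simp: vertex_set_defs)
  have inj': "f u = f v \<longleftrightarrow> u = v"
    if "u \<in> big_clique d \<union> links d" "v \<in> big_clique d \<union> links d" for u v
    using inj that by (auto simp: vertices_def inj_on_eq_iff)
  have disj: "big_clique d \<inter> links d = {}"
    by (auto simp: big_clique_def links_def)
  have ne: "big_clique d \<noteq> {}" by (auto simp: big_clique_def)
  have adj_clique: "adj u v \<longleftrightarrow> u \<in> big_clique d \<and> v \<in> big_clique d \<and> u \<noteq> v"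
    if "u \<in> big_clique d \<union> links d" "v \<in> big_clique d \<union> links d" for u v
    using that by (auto simp: big_clique_def links_def)
  have verts: "f ` vertices d - f ` hubs d = f ` (big_clique d \<union> links d)"
    using inj sub by (simp add: inj_on_image_set_diff[where C = "vertices d"] flip: rest)
  have "partition_on (f ` (big_clique d \<union> links d)) P"
  proof (rule partition_onI)
    show "\<Union>P = f ` (big_clique d \<union> links d)" by (auto simp: P_def)
    show "{} \<notin> P" using ne by (auto simp: P_def)
    show "disjnt p q" if "p \<in> P" "q \<in> P" "p \<noteq> q" for p q
    proof -
      have "f u \<noteq> f w" if "u \<in> big_clique d" "w \<in> links d" for u w
        using that inj'[of u w] disj by auto
      then show ?thesis
        using \<open>p \<in> P\<close> \<open>q \<in> P\<close> \<open>p \<noteq> q\<close> by (auto simp: P_def disjnt_def) metis+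
    qed
  qed
  moreover have "{(f u, f v) |u v. u \<in> vertices d - hubs d \<and> v \<in> vertices d - hubs d \<and> adj u v}
      = {(x, y). x \<noteq> y \<and> (\<exists>K \<in> P. x \<in> K \<and> y \<in> K)}"
  proof -
    have "{(f u, f v) |u v. u \<in> vertices d - hubs d \<and> v \<in> vertices d - hubs d \<and> adj u v}
        = {(f u, f v) |u v. u \<in> big_clique d \<and> v \<in> big_clique d \<and> u \<noteq> v}"
      unfolding rest using adj_clique by blast
    also have "\<dots> = {(x, y). x \<noteq> y \<and> x \<in> f ` big_clique d \<and> y \<in> f ` big_clique d}"
      using inj' by blast
    also have "\<dots> = {(x, y). x \<noteq> y \<and> (\<exists>K \<in> P. x \<in> K \<and> y \<in> K)}"
      by (auto simp: P_def)
    finally show ?thesis .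
  qed
  ultimately show ?thesis
    unfolding disjoint_union_of_cliques_def
    using arcs_ends_induce_relabeled[OF inj sub, of adj]
    by (intro exI[of _ P]) (simp add: extremal_graph_def verts)
qed

lemma dist_to_cluster_extremal_graph:
  assumes inj: "inj_on f (vertices d)"
  shows "dist_to_cluster (with_proj (extremal_graph d f)) = d"
  unfolding dist_to_cluster_def
proof (rule Least_equality)
  have verts: "verts (with_proj (extremal_graph d f)) = f ` vertices d"
    by (simp add: extremal_graph_def verts_relabeled del: with_proj_simps)
  have sub: "hubs d \<subseteq> vertices d" by (auto simp: vertices_def)
  have "card (f ` hubs d) = d"
    using inj_on_subset[OF inj sub] by (simp add: card_image hubs_def inj_on_def)
  then show "\<exists>Y \<subseteq> verts (with_proj (extremal_graph d f)). finite Y \<and> card Y = d \<and>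
      disjoint_union_of_cliques
        (with_proj (extremal_graph d f) \<restriction> (verts (with_proj (extremal_graph d f)) - Y))"
    unfolding verts using hubs_deletion_cluster[OF inj] sub
    by (intro exI[of _ "f ` hubs d"]) (auto simp: hubs_def)
  fix m assume "\<exists>Y \<subseteq> verts (with_proj (extremal_graph d f)). finite Y \<and> card Y = m \<and>
      disjoint_union_of_cliques
        (with_proj (extremal_graph d f) \<restriction> (verts (with_proj (extremal_graph d f)) - Y))"
  then obtain Y where Y: "Y \<subseteq> f ` vertices d" "finite Y" "card Y = m"
      and cluster: "disjoint_union_of_cliques (with_proj (extremal_graph d f) \<restriction> (f ` vertices d - Y))"
    unfolding verts by blast
  obtain Z where Z: "Z \<subseteq> vertices d" "Y = f ` Z"
    using Y(1) by (meson subset_imageE)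
  have "inj_on f Z" using inj Z(1) by (rule inj_on_subset)
  have arcs: "arcs_ends (with_proj (extremal_graph d f) \<restriction> (f ` vertices d - Y))
      = {(f u, f v) |u v. u \<in> vertices d - Z \<and> v \<in> vertices d - Z \<and> adj u v}"
    unfolding extremal_graph_def Z(2) by (rule arcs_ends_induce_relabeled[OF inj Z(1)])
  have "d \<le> card Z"
  proof (rule card_ge_if_disjoint_hit)
    show "finite Z" using Z(1) finite_vertices by (rule finite_subset)
    show "{W i i, X i, U {i} 0} \<inter> {W j j, X j, U {j} 0} = {}" if "i \<noteq> j" for i j
      using that by auto
    \<comment> \<open>If \<open>Z\<close> missed this triple, both arcs at \<open>X i\<close> would
      survive, and the cluster property would force the absent arc from \<open>W i i\<close> to
      \<open>U {i} 0\<close>.\<close>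
    show "{W i i, X i, U {i} 0} \<inter> Z \<noteq> {}" if "i < d" for i
    proof
      assume disj: "{W i i, X i, U {i} 0} \<inter> Z = {}"
      let ?arcs = "arcs_ends (with_proj (extremal_graph d f) \<restriction> (f ` vertices d - Y))"
      have V: "W i i \<in> vertices d" "X i \<in> vertices d" "U {i} 0 \<in> vertices d"
        using that by (auto simp: vertices_iff)
      have "(f (W i i), f (X i)) \<in> ?arcs" "(f (X i), f (U {i} 0)) \<in> ?arcs"
        unfolding arcs using V disj by fastforce+
      moreover have "f (W i i) \<noteq> f (U {i} 0)"
        using V inj by (auto simp: inj_on_eq_iff)
      ultimately have "(f (W i i), f (U {i} 0)) \<in> ?arcs"
        by (rule disjoint_union_of_cliques_trans[OF cluster])
      then obtain u v where "f (W i i) = f u" "f (U {i} 0) = f v"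
          "u \<in> vertices d" "v \<in> vertices d" "adj u v"
        unfolding arcs by auto
      then have "adj (W i i) (U {i} 0)"
        using V inj by (simp add: inj_on_eq_iff)
      then show False by simp
    qed
  qed
  also have "card Z = m"
    using Y(3) Z(2) \<open>inj_on f Z\<close> by (simp add: card_image)
  finally show "d \<le> m" .
qed

theorem theorem2:
  fixes d :: nat
  assumes "d \<ge> 1"
  shows "\<exists>G :: nat pair_pre_digraph. pair_graph G \<and> CFON_colorable (with_proj G) \<and>
           dist_to_cluster (with_proj G) = d \<and> chi_ON (with_proj G) > d"
proof -
  obtain f :: "vertex \<Rightarrow> nat" where inj: "inj_on f (vertices d)"
    using finite_imp_inj_to_nat_seg[OF finite_vertices] by blast
  let ?G = "extremal_graph d f"
  have "pair_graph ?G"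
    unfolding extremal_graph_def using finite_vertices inj
    by (rule pair_graph_relabeled) (auto simp: symp_def irreflp_def adj_commute not_adj_self)
  moreover have colorable: "CFON_colorable (with_proj ?G)"
    unfolding extremal_graph_def using finite_vertices inj no_isolated_vertex[OF assms]
    by (rule CFON_colorable_relabeled)
  moreover have "dist_to_cluster (with_proj ?G) = d"
    using inj by (rule dist_to_cluster_extremal_graph)
  moreover have "chi_ON (with_proj ?G) > d"
  proof -
    \<comment> \<open>Colorability makes the least number attained, so \<open>chi_ON\<close> is the
      size of an actual coloring and not an arbitrary value.\<close>
    have "\<exists>C. CFON_coloring (with_proj ?G) (chi_ON (with_proj ?G)) C"
      unfolding chi_ON_def using colorable unfolding CFON_colorable_def by (rule LeastI_ex)
    then show ?thesis
      using CFON_coloring_extremal_graph[OF inj] by blast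
  qed
  ultimately show ?thesis by blast
qed

end
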